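(* Let $X := \mathcal{C}([0,+\infty)) \cap L^1([0,+\infty))$ and let $$\mathcal{A} = \left\{ f \in X : \limsup_{x \to +\infty} |f(x)| = +\infty \right\}.$$ Then $\mathcal{A}$ is maximal lineable in $X$; that is, there is a vector subspace $M \subset X$ with $\dim(M)=\dim(X)$ (infinite) such that $M\setminus\{0\}\subset \mathcal{A}$.
   Context: $\mathcal{C}([0,+\infty))$ is the real vector space of all continuous functions $[0,+\infty)\to\mathbb{R}$, and $L^1([0,+\infty))$ is the space of Lebesgue integrable functions on $[0,+\infty)$. Dimension means algebraic (Hamel) dimension over $\mathbb{R}$; $\dim(X)=\mathfrak{c}$, the cardinality of the continuum. A subset $A$ of a vector space $X$ is $\alpha$-lineable if there is an infinite-dimensional vector space $M\subset X$ with $\dim(M)=\alpha$ and $M\setminus\{0\}\subset A$; it is maximal lineable if it is $\dim(X)$-lineable. *)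

theory Defs
  imports "HOL-Analysis.Analysis" "HOL-Library.Function_Algebras"
begin

unbundle cardinal_syntax

instantiation "fun" :: (type, real_vector) real_vector
begin

definition scaleR_fun :: "real \<Rightarrow> ('a \<Rightarrow> 'b) \<Rightarrow> 'a \<Rightarrow> 'b"
  where "scaleR_fun c f = (\<lambda>x. c *\<^sub>R f x)"

instance
  by standard (auto simp: scaleR_fun_def fun_eq_iff scaleR_add_right scaleR_add_left)

end

lemma scaleR_fun_apply [simp]: "(c *\<^sub>R f) x = c *\<^sub>R f x"
  by (simp add: scaleR_fun_def)


(* The Hamel dimension as a cardinal.  The library constant dim has type nat and does not
   distinguish infinite dimensions; this is the same definition with card replaced by card_of. *)
definition hamel_dim :: "'a::real_vector set \<Rightarrow> 'a rel"
  where "hamel_dim V = |SOME B. independent B \<and> span B = span V|"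

lemma hamel_dim_eq:
  fixes B V :: "'a::real_vector set"
  assumes "independent B" and "span B = span V"
  shows "|B| =o hamel_dim V"
proof -
  define C where "C = (SOME B. independent B \<and> span B = span V)"
  have "independent C \<and> span C = span V"
    unfolding C_def by (rule someI[of _ B]) (use assms in simp)
  then obtain f where "bij_betw f B C"
    using real_vector.bij_if_span_eq_span_bases[of B C] assms by auto
  then have "|B| =o |C|"
    using card_of_ordIso by blast
  then show ?thesis
    by (simp add: hamel_dim_def C_def)
qed

definition lineable_in :: "'a::real_vector set \<Rightarrow> 'a set \<Rightarrow> 'b rel \<Rightarrow> bool"
  where "lineable_in X A \<alpha> \<longleftrightarrow> subspace X \<and> A \<subseteq> X \<and>
    (\<exists>M. subspace M \<and> M \<subseteq> X \<and> cinfinite (hamel_dim M) \<and> hamel_dim M =o \<alpha> \<and> M - {0} \<subseteq> A)"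

definition maximal_lineable_in :: "'a::real_vector set \<Rightarrow> 'a set \<Rightarrow> bool"
  where "maximal_lineable_in X A \<longleftrightarrow> lineable_in X A (hamel_dim X)"


(* A function on [0,+oo) is represented by its extension by zero to the real line, so that
   equality of representatives is equality on [0,+oo). *)
definition functions_halfline :: "(real \<Rightarrow> real) set"
  where "functions_halfline = {f. \<forall>x<0. f x = 0}"

definition C_halfline :: "(real \<Rightarrow> real) set"
  where "C_halfline = {f \<in> functions_halfline. continuous_on {0..} f}"

(* Honest functions rather than classes modulo null sets: L1_halfline is only intersected with
   C_halfline, where functions equal almost everywhere are equal. *)
definition L1_halfline :: "(real \<Rightarrow> real) set"
  where "L1_halfline = {f \<in> functions_halfline. set_integrable lebesgue {0..} f}"

definition CL1_halfline :: "(real \<Rightarrow> real) set"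
  where "CL1_halfline = C_halfline \<inter> L1_halfline"

definition limsup_infinite :: "(real \<Rightarrow> real) set"
  where "limsup_infinite = {f \<in> CL1_halfline. Limsup at_top (\<lambda>x. ereal \<bar>f x\<bar>) = \<infinity>}"

lemma subspace_CL1_halfline: "subspace CL1_halfline"
  unfolding CL1_halfline_def C_halfline_def L1_halfline_def functions_halfline_def
  by (intro subspaceI)
     (auto intro!: continuous_intros simp: plus_fun_def zero_fun_def scaleR_fun_def
           set_integrable_def algebra_simps
           dest: Bochner_Integration.integrable_add)

end

theory Submission
  imports Defs
begin

text \<open>
  The idea is to multiply exponentials by one fixed function so thin that the products are
  integrable, yet equal to one at every natural number. Let \<open>tent\<close> be continuous on the half-line
  with values in \<open>[0, 1]\<close>, with \<open>tent n = 1\<close> for every natural \<open>n\<close>, and supported within distance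
  of order \<open>exp (- 2 n)\<close> of the natural numbers \<open>n\<close>. For \<open>t \<le> 1\<close> the function
  \<open>spike t x = exp (t x) * tent x\<close> then has mass at most of order \<open>exp n * exp (- 2 n)\<close> around \<open>n\<close>,
  so it is integrable (\<open>integrable_spike\<close>).

  At the natural numbers a linear combination of spikes is just an exponential sum
  \<open>\<Sum>t. c t * exp (t n)\<close>. If all exponents are positive and some coefficient is nonzero, the term
  with the largest exponent among those with nonzero coefficient dominates, and the absolute
  value tends to infinity (\<open>exponential_sum_at_top\<close>). Hence every nontrivial combination of the
  spikes with \<open>0 < t < 1\<close> lies in \<open>limsup_infinite\<close>
  (\<open>spike_combination_in_limsup_infinite\<close>). As the zero function does not, the spikes are
  linearly independent, and their span \<open>M\<close> meets the requirement on \<open>M - {0}\<close>.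

  The dimension of \<open>M\<close> is the cardinality of the open unit interval, that is, of the continuum.
  The whole space has no larger dimension, since it has no larger cardinality: a continuous
  function is determined by its values at the rationals, and these are encoded by a set of pairs
  of rationals (\<open>card_C_halfline\<close>).
\<close>

section \<open>Spikes at the natural numbers\<close>

text \<open>
  The slope \<open>exp (2 * x)\<close> is chosen to beat the growth of \<open>exp (t * x)\<close> for \<open>t \<le> 1\<close>. The distance to
  the set of natural numbers yields continuity without gluing infinitely many separate bumps.
\<close>
definition tent :: "real \<Rightarrow> real"
  where "tent x = indicator {0..} x * max 0 (1 - exp (2 * x) * infdist x \<nat>)"

definition spike :: "real \<Rightarrow> real \<Rightarrow> real"
  where "spike t x = exp (t * x) * tent x"

lemma tent_nonneg: "0 \<le> tent x"
  by (simp add: tent_def)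

lemma tent_le_one: "tent x \<le> 1"
  using infdist_nonneg[of x \<nat>] by (auto simp: tent_def indicator_def)

lemma tent_of_nat [simp]: "tent (real n) = 1"
  by (simp add: tent_def)

lemma continuous_on_tent: "continuous_on {0..} tent"
proof -
  have "continuous_on {0..} (\<lambda>x::real. max 0 (1 - exp (2 * x) * infdist x \<nat>))"
    by (intro continuous_intros)
  then show ?thesis
    by (rule continuous_on_eq) (simp add: tent_def)
qed

text \<open>
  The width is expressed through \<open>n\<close> instead of \<open>x\<close>, so that the support is covered by
  fixed intervals whose lengths can be summed; passing from \<open>x\<close> to \<open>n\<close> costs only a constant
  factor because the two differ by at most one.
\<close>
lemma tent_support:
  assumes "tent x \<noteq> 0"
  obtains n :: nat where "\<bar>x - real n\<bar> \<le> exp (2 - 2 * real n)" and "x \<le> real n + 1"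
proof -
  have x: "0 \<le> x" and d: "exp (2 * x) * infdist x \<nat> < 1"
    using assms by (auto simp: tent_def indicator_def split: if_splits)
  have "infdist x \<nat> < exp (- 2 * x)"
    using d by (simp add: exp_minus field_simps)
  then have "(INF a\<in>\<nat>. dist x a) < exp (- 2 * x)"
    by (simp add: infdist_def split: if_splits)
  then obtain a :: real where "a \<in> \<nat>" "dist x a < exp (- 2 * x)"
    by (subst (asm) cINF_less_iff) auto
  then obtain n :: nat where n: "\<bar>x - real n\<bar> < exp (- 2 * x)"
    by (auto simp: Nats_def dist_real_def)
  have "exp (- 2 * x) \<le> 1"
    using x by simp
  then have near: "\<bar>x - real n\<bar> \<le> 1"
    using n by linarith
  then have "exp (- 2 * x) \<le> exp (2 - 2 * real n)"
    by simp
  then have "\<bar>x - real n\<bar> \<le> exp (2 - 2 * real n)"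
    using n by linarith
  then show thesis
    using near by (intro that[of n]) auto
qed

text \<open>
  One integrable majorant for all admissible exponents: a step function whose integral is a
  geometric series with ratio \<open>exp (- 1)\<close>.
\<close>
lemma spike_le_suminf:
  assumes "t \<le> 1"
  shows "ennreal (spike t x) \<le>
    (\<Sum>n. ennreal (exp (real n + 1)) *
      indicator {real n - exp (2 - 2 * real n)..real n + exp (2 - 2 * real n)} x)"
    (is "_ \<le> suminf ?f")
proof (cases "tent x = 0")
  case True
  then show ?thesis by (simp add: spike_def)
next
  case False
  then obtain n :: nat where n: "\<bar>x - real n\<bar> \<le> exp (2 - 2 * real n)" "x \<le> real n + 1"
    by (rule tent_support)
  have x: "0 \<le> x"
    using False by (auto simp: tent_def indicator_def split: if_splits)
  have "t * x \<le> 1 * x"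
    by (rule mult_right_mono) (use assms x in auto)
  with n have tx: "t * x \<le> real n + 1"
    by linarith
  have "spike t x \<le> exp (t * x) * 1"
    unfolding spike_def by (intro mult_left_mono tent_le_one) simp
  also have "\<dots> \<le> exp (real n + 1)"
    using tx by simp
  finally have "ennreal (spike t x) \<le> ?f n"
    using n by (auto simp: indicator_def abs_le_iff intro!: ennreal_leI)
  also have "\<dots> = sum ?f {n}"
    by (simp only: sum.insert sum.empty finite.emptyI empty_iff not_False_eq_True add_0_right)
  also have "\<dots> \<le> suminf ?f"
    by (intro sum_le_suminf) auto
  finally show ?thesis .
qed

lemma borel_measurable_spike: "spike t \<in> borel_measurable borel"
proof -
  have "(\<lambda>x. indicator {0..} x *\<^sub>R tent x) \<in> borel_measurable borel"
    by (intro borel_measurable_continuous_on_indicator continuous_on_tent) simp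
  moreover have "(\<lambda>x. indicator {0..} x *\<^sub>R tent x) = tent"
    by (auto simp: tent_def indicator_def)
  ultimately have "tent \<in> borel_measurable borel"
    by simp
  then show ?thesis
    unfolding spike_def [abs_def] by measurable
qed

lemma integrable_spike:
  assumes "t \<le> 1"
  shows "integrable lborel (spike t)"
proof (rule integrableI_nonneg)
  show "spike t \<in> borel_measurable lborel"
    using borel_measurable_spike by simp
  show "AE x in lborel. 0 \<le> spike t x"
    by (simp add: spike_def tent_nonneg)
  let ?I = "\<lambda>n::nat. {real n - exp (2 - 2 * real n)..real n + exp (2 - 2 * real n)}"
  have nn_integral_I: "(\<integral>\<^sup>+x. ennreal (exp (real n + 1)) * indicator (?I n) x \<partial>lborel)
      = ennreal (2 * exp 3 * exp (- 1) ^ n)" for n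
  proof -
    have "(\<integral>\<^sup>+x. ennreal (exp (real n + 1)) * indicator (?I n) x \<partial>lborel)
        = ennreal (exp (real n + 1)) * ennreal (2 * exp (2 - 2 * real n))"
      by (simp add: nn_integral_cmult_indicator)
    also have "\<dots> = ennreal (2 * (exp (real n + 1) * exp (2 - 2 * real n)))"
      by (simp add: ennreal_mult[symmetric] mult_ac)
    also have "exp (real n + 1) * exp (2 - 2 * real n) = exp 3 * exp (- 1) ^ n"
      by (simp add: exp_add[symmetric] exp_of_nat_mult[symmetric])
    finally show ?thesis
      by (simp add: mult_ac)
  qed
  have summ: "summable (\<lambda>n. 2 * exp 3 * exp (- 1 :: real) ^ n)"
    by (intro summable_mult summable_geometric) simp
  have "(\<integral>\<^sup>+x. ennreal (spike t x) \<partial>lborel)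
      \<le> (\<integral>\<^sup>+x. (\<Sum>n. ennreal (exp (real n + 1)) * indicator (?I n) x) \<partial>lborel)"
    by (intro nn_integral_mono spike_le_suminf assms)
  also have "\<dots> = (\<Sum>n. \<integral>\<^sup>+x. ennreal (exp (real n + 1)) * indicator (?I n) x \<partial>lborel)"
    by (rule nn_integral_suminf) measurable
  also have "\<dots> = (\<Sum>n. ennreal (2 * exp 3 * exp (- 1) ^ n))"
    by (simp only: nn_integral_I)
  also have "\<dots> = ennreal (\<Sum>n. 2 * exp 3 * exp (- 1) ^ n)"
    by (rule suminf_ennreal2[OF _ summ]) simp
  also have "\<dots> < \<infinity>"
    by simp
  finally show "(\<integral>\<^sup>+x. ennreal (spike t x) \<partial>lborel) < \<infinity>" .
qed

lemma spike_in_CL1_halfline: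
  assumes "t \<le> 1"
  shows "spike t \<in> CL1_halfline"
proof -
  have zero: "spike t x = 0" if "x < 0" for x
    using that by (simp add: spike_def tent_def)
  have "continuous_on {0..} (spike t)"
    unfolding spike_def [abs_def] by (intro continuous_intros continuous_on_tent)
  moreover have "integrable lebesgue (spike t)"
    using integrable_spike[OF assms] borel_measurable_spike[of t]
    by (simp add: integrable_completion)
  moreover have "(\<lambda>x. indicator {0..} x *\<^sub>R spike t x) = spike t"
    using zero by (intro ext) (auto simp: indicator_def not_le)
  ultimately show ?thesis
    using zero
    by (simp add: CL1_halfline_def C_halfline_def L1_halfline_def functions_halfline_def
        set_integrable_def)
qed

lemma inj_spike: "inj spike"
proof (rule injI)
  fix s t assume "spike s = spike t"
  then have "spike s (real 1) = spike t (real 1)"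
    by simp
  then show "s = t"
    unfolding spike_def tent_of_nat by simp
qed

section \<open>Linear combinations of spikes\<close>

text \<open>
  Let \<open>T\<close> be the largest exponent with a nonzero coefficient. After division by \<open>exp (T * x)\<close>,
  every other term tends to zero, so the quotient tends to the nonzero number \<open>c T\<close>.
\<close>
lemma exponential_sum_at_top:
  fixes c :: "real \<Rightarrow> real"
  assumes "finite S" and pos: "\<And>t. t \<in> S \<Longrightarrow> 0 < t" and "t0 \<in> S" "c t0 \<noteq> 0"
  shows "filterlim (\<lambda>x. \<bar>\<Sum>t\<in>S. c t * exp (t * x)\<bar>) at_top at_top"
proof -
  define S' where "S' = {t \<in> S. c t \<noteq> 0}"
  define T where "T = Max S'"
  have fin: "finite S'" and ne: "S' \<noteq> {}"
    using assms by (auto simp: S'_def)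
  have TS: "T \<in> S'" and T_max: "\<And>t. t \<in> S' \<Longrightarrow> t \<le> T"
    using fin ne by (auto simp: T_def)
  then have T: "0 < T" "c T \<noteq> 0"
    using pos by (auto simp: S'_def)
  have "((\<lambda>x. c t * exp ((t - T) * x)) \<longlongrightarrow> (if t = T then c T else 0)) at_top"
    if "t \<in> S'" for t
  proof (cases "t = T")
    case False
    then have "t - T < 0"
      using T_max[OF that] by simp
    then have "filterlim (\<lambda>x. (t - T) * x) at_bot at_top"
      by (intro filterlim_tendsto_neg_mult_at_bot[OF tendsto_const] filterlim_ident)
    then have "((\<lambda>x. exp ((t - T) * x)) \<longlongrightarrow> 0) at_top"
      by (rule filterlim_compose[OF exp_at_bot])
    then show ?thesis
      using False by (auto intro: tendsto_mult_right_zero)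
  qed simp
  then have "((\<lambda>x. \<Sum>t\<in>S'. c t * exp ((t - T) * x)) \<longlongrightarrow> (\<Sum>t\<in>S'. if t = T then c T else 0)) at_top"
    by (rule tendsto_sum)
  then have "((\<lambda>x. \<bar>\<Sum>t\<in>S'. c t * exp ((t - T) * x)\<bar>) \<longlongrightarrow> \<bar>c T\<bar>) at_top"
    using fin TS by (intro tendsto_rabs) simp
  moreover have "filterlim (\<lambda>x. exp (T * x)) at_top at_top"
    using T by (intro filterlim_compose[OF exp_at_top]
        filterlim_tendsto_pos_mult_at_top[OF tendsto_const] filterlim_ident)
  ultimately have "filterlim (\<lambda>x. \<bar>\<Sum>t\<in>S'. c t * exp ((t - T) * x)\<bar> * exp (T * x)) at_top at_top"
    using filterlim_tendsto_pos_mult_at_top T by fastforce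
  moreover have "\<bar>\<Sum>t\<in>S'. c t * exp ((t - T) * x)\<bar> * exp (T * x) = \<bar>\<Sum>t\<in>S. c t * exp (t * x)\<bar>"
    for x
  proof -
    have "(\<Sum>t\<in>S. c t * exp (t * x)) = (\<Sum>t\<in>S'. c t * exp (t * x))"
      using assms(1) by (intro sum.mono_neutral_right) (auto simp: S'_def)
    also have "\<dots> = (\<Sum>t\<in>S'. c t * exp ((t - T) * x)) * exp (T * x)"
      unfolding sum_distrib_right
      by (intro sum.cong refl) (simp add: mult.assoc exp_add[symmetric] left_diff_distrib)
    finally show ?thesis
      by (simp add: abs_mult)
  qed
  ultimately show ?thesis
    by simp
qed

lemma Limsup_abs_eq_infinity:
  fixes f :: "real \<Rightarrow> real"
  assumes "filterlim (\<lambda>n. \<bar>f (real n)\<bar>) at_top sequentially"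
  shows "Limsup at_top (\<lambda>x. ereal \<bar>f x\<bar>) = \<infinity>"
proof (rule ccontr)
  assume "\<not> ?thesis"
  then have "Limsup at_top (\<lambda>x. ereal \<bar>f x\<bar>) < \<infinity>"
    by simp
  then obtain C where "Limsup at_top (\<lambda>x. ereal \<bar>f x\<bar>) < ereal C"
    using ereal_dense2 by blast
  then have "\<forall>\<^sub>F x in at_top. \<bar>f x\<bar> < C"
    by (auto dest: Limsup_lessD)
  then have "\<forall>\<^sub>F n in sequentially. \<bar>f (real n)\<bar> < C"
    by (rule eventually_compose_filterlim[OF _ filterlim_real_sequentially])
  moreover have "\<forall>\<^sub>F n in sequentially. C \<le> \<bar>f (real n)\<bar>"
    using assms by (simp add: filterlim_at_top)
  ultimately have "\<forall>\<^sub>F n in sequentially. False"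
    by eventually_elim simp
  then show False
    by simp
qed

lemma sum_fun_apply: "(\<Sum>i\<in>A. F i) x = (\<Sum>i\<in>A. F i x)"
  for F :: "'i \<Rightarrow> 'a \<Rightarrow> 'b::comm_monoid_add"
  by (induction A rule: infinite_finite_induct) auto

text \<open>
  This single fact serves twice: it gives the independence of the spikes, and the inclusion of
  the nonzero part of their span. Only the values at natural numbers matter, where the
  combination is an exponential sum.
\<close>
lemma spike_combination_in_limsup_infinite:
  assumes "finite B" "B \<subseteq> spike ` {0<..<1}" and v: "v \<in> B" "u v \<noteq> 0"
  shows "(\<Sum>b\<in>B. u b *\<^sub>R b) \<in> limsup_infinite"
proof -
  obtain S where S: "S \<subseteq> {0<..<1}" "B = spike ` S"
    using assms by (auto simp: subset_image_iff)
  have inj: "inj_on spike S"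
    using inj_spike by (rule inj_on_subset) simp
  have "finite S"
    using assms S inj finite_imageD by blast
  obtain t0 where t0: "t0 \<in> S" "v = spike t0"
    using v S by auto
  let ?g = "\<Sum>b\<in>B. u b *\<^sub>R b"
  have "filterlim (\<lambda>n. \<bar>\<Sum>t\<in>S. u (spike t) * exp (t * real n)\<bar>) at_top sequentially"
    by (rule filterlim_compose[OF exponential_sum_at_top filterlim_real_sequentially])
      (use \<open>finite S\<close> S t0 v in auto)
  moreover have "?g (real n) = (\<Sum>t\<in>S. u (spike t) * exp (t * real n))" for n
    unfolding S sum.reindex[OF inj] by (simp add: sum_fun_apply spike_def)
  ultimately have "Limsup at_top (\<lambda>x. ereal \<bar>?g x\<bar>) = \<infinity>"
    by (intro Limsup_abs_eq_infinity) simp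
  moreover have "?g \<in> CL1_halfline"
    using S by (intro subspace_sum subspace_CL1_halfline subspace_scale)
      (auto intro!: spike_in_CL1_halfline)
  ultimately show ?thesis
    by (simp add: limsup_infinite_def)
qed

lemma zero_notin_limsup_infinite: "0 \<notin> limsup_infinite"
  by (simp add: limsup_infinite_def Limsup_const)

lemma independent_spikes: "independent (spike ` {0<..<1})"
proof
  assume "dependent (spike ` {0<..<1})"
  then obtain B u v where "finite B" "B \<subseteq> spike ` {0<..<1}" "v \<in> B" "u v \<noteq> 0"
    and sum0: "(\<Sum>b\<in>B. u b *\<^sub>R b) = 0"
    unfolding real_vector.dependent_explicit by blast
  then have "(\<Sum>b\<in>B. u b *\<^sub>R b) \<in> limsup_infinite"
    by (intro spike_combination_in_limsup_infinite)
  then show False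
    unfolding sum0 using zero_notin_limsup_infinite by contradiction
qed

lemma span_spikes_subset: "span (spike ` {0<..<1}) - {0} \<subseteq> limsup_infinite"
proof
  fix g assume g: "g \<in> span (spike ` {0<..<1}) - {0}"
  then obtain B u where B: "finite B" "B \<subseteq> spike ` {0<..<1}" "g = (\<Sum>b\<in>B. u b *\<^sub>R b)"
    by (auto simp: real_vector.span_explicit)
  have "\<exists>v\<in>B. u v \<noteq> 0"
  proof (rule ccontr)
    assume "\<not> ?thesis"
    then have "g = 0"
      unfolding B(3) by (intro sum.neutral) simp
    with g show False
      by simp
  qed
  then obtain v where "v \<in> B" "u v \<noteq> 0"
    by blast
  then show "g \<in> limsup_infinite"
    unfolding B(3) by (intro spike_combination_in_limsup_infinite B(1,2))
qed

section \<open>Cardinalities\<close>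

lemma card_spikes: "|spike ` {0<..<1}| =o |UNIV :: real set|"
proof -
  have "|spike ` {0<..<1}| =o |{0<..<1::real}|"
  proof (rule ordIso_symmetric, rule card_of_ordIsoI)
    show "bij_betw spike {0<..<1} (spike ` {0<..<1})"
      by (intro inj_on_imp_bij_betw inj_on_subset[OF inj_spike] subset_UNIV)
  qed
  moreover have "|{0<..<1::real}| =o |UNIV :: real set|"
    using open_interval_eqpoll_reals[of 0 1] by (simp add: eqpoll_iff_card_of_ordIso)
  ultimately show ?thesis
    by (rule ordIso_transitive)
qed

text \<open>
  Agreement at the positive rationals extends by density to the closed half-line; on the
  negative axis both functions vanish by convention.
\<close>
lemma continuous_halfline_eqI:
  assumes "f \<in> C_halfline" "g \<in> C_halfline"
    and eq: "\<And>q. q \<in> \<rat> \<Longrightarrow> 0 < q \<Longrightarrow> f q = g q"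
  shows "f = g"
proof -
  have cont: "continuous_on {0..} (\<lambda>x. f x - g x)" and neg: "\<And>x. x < 0 \<Longrightarrow> f x = g x"
    using assms(1,2) by (auto simp: C_halfline_def functions_halfline_def intro: continuous_intros)
  have dense: "closure ({0<..} \<inter> \<rat>) = {0::real..}"
    by (simp add: closure_open_Int_superset Rats_closure_real)
  have "f x - g x = 0" if "x \<in> closure ({0<..} \<inter> \<rat>)" for x
    by (rule continuous_constant_on_closure[of "{0<..} \<inter> \<rat>" "\<lambda>x. f x - g x"])
      (use cont eq that in \<open>simp_all add: dense\<close>)
  then have "f x = g x" for x
    using neg[of x] by (cases "x < 0") (auto simp: dense)
  then show ?thesis
    by blast
qed

text \<open>
  A real number is determined by the rationals below it, so the values of a function at all
  rationals are encoded by one set of pairs of rationals; there are continuum many such sets.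
\<close>
lemma card_C_halfline: "|C_halfline| \<le>o |UNIV :: real set|"
proof -
  define cut where "cut f = {(p, q). real_of_rat q < f (real_of_rat p)}" for f :: "real \<Rightarrow> real"
  have "inj_on cut C_halfline"
  proof (rule inj_onI)
    fix f g assume fg: "f \<in> C_halfline" "g \<in> C_halfline" "cut f = cut g"
    have iff: "real_of_rat q < f (real_of_rat p) \<longleftrightarrow> real_of_rat q < g (real_of_rat p)" for p q
      using fg(3) by (auto simp: cut_def set_eq_iff)
    have "f (real_of_rat p) = g (real_of_rat p)" for p
      proof (rule ccontr)
      assume "f (real_of_rat p) \<noteq> g (real_of_rat p)"
      then consider "f (real_of_rat p) < g (real_of_rat p)" | "g (real_of_rat p) < f (real_of_rat p)"
        by linarith
      then show False
        using iff of_rat_dense by cases (meson less_asym)+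
    qed
    then show "f = g"
      using fg by (intro continuous_halfline_eqI) (auto simp: Rats_def)
  qed
  then have "inj_on ((`) to_nat \<circ> cut) C_halfline"
    by (intro comp_inj_on) (auto intro: inj_on_subset[OF inj_on_image[OF inj_on_subset]])
  then have "|C_halfline| \<le>o |UNIV :: nat set set|"
    by (intro iffD1[OF card_of_ordLeq]) auto
  then show ?thesis
    using nat_sets_eqpoll_reals ordLeq_ordIso_trans by (auto simp: eqpoll_iff_card_of_ordIso)
qed

lemma hamel_dim_span_independent:
  assumes "independent B"
  shows "hamel_dim (span B) =o |B|"
  by (rule ordIso_symmetric[OF hamel_dim_eq]) (simp_all add: assms span_span)

text \<open>
  Extending the independent family of spikes to a basis gives the lower bound; the upper bound
  holds because a basis is a subset of a space of cardinality at most the continuum.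
\<close>
lemma hamel_dim_CL1_halfline: "hamel_dim CL1_halfline =o |UNIV :: real set|"
proof -
  have sub: "spike ` {0<..<1} \<subseteq> CL1_halfline"
    by (auto intro: spike_in_CL1_halfline)
  obtain B where B: "spike ` {0<..<1} \<subseteq> B" "B \<subseteq> CL1_halfline" "independent B"
      "CL1_halfline \<subseteq> span B"
    using real_vector.maximal_independent_subset_extend[OF sub independent_spikes] by blast
  have "|UNIV :: real set| \<le>o |B|"
    using card_spikes card_of_mono1[OF B(1)] ordIso_symmetric ordIso_ordLeq_trans by blast
  moreover have "|B| \<le>o |UNIV :: real set|"
    using B(2) card_C_halfline card_of_mono1 ordLeq_transitive
    by (metis CL1_halfline_def le_inf_iff)
  ultimately have "|B| =o |UNIV :: real set|"
    by (simp add: ordIso_iff_ordLeq)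
  moreover have "span B = span CL1_halfline"
    using B by (metis span_mono span_span subset_antisym)
  ultimately show ?thesis
    using B(3) hamel_dim_eq ordIso_symmetric ordIso_transitive by blast
qed

theorem theorem2p3:
  shows "maximal_lineable_in CL1_halfline limsup_infinite"
proof -
  let ?M = "span (spike ` {0<..<1})"
  have "hamel_dim ?M =o |spike ` {0<..<1}|"
    by (rule hamel_dim_span_independent[OF independent_spikes])
  then have dim: "hamel_dim ?M =o |UNIV :: real set|"
    using card_spikes ordIso_transitive by blast
  have "cinfinite |UNIV :: real set|"
    by (simp add: cinfinite_def Field_card_of infinite_UNIV_char_0)
  then have "cinfinite (hamel_dim ?M)"
    using dim
    by (metis card_of_Card_order cinfinite_mono ordIso_iff_ordLeq)
  moreover have "hamel_dim ?M =o hamel_dim CL1_halfline"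
    using dim hamel_dim_CL1_halfline ordIso_symmetric ordIso_transitive by blast
  moreover have "?M \<subseteq> CL1_halfline"
    by (rule span_minimal[OF _ subspace_CL1_halfline]) (auto intro: spike_in_CL1_halfline)
  moreover have "limsup_infinite \<subseteq> CL1_halfline"
    by (auto simp: limsup_infinite_def)
  ultimately show ?thesis
    unfolding maximal_lineable_in_def lineable_in_def
    using subspace_CL1_halfline subspace_span span_spikes_subset by blast
qed

end
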